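(* Let $x: I\subset\mathbb{R}\to E_1^4$, with $0\in I$, be a unit speed spacelike curve in Minkowski 4-space with Frenet frame $\{T,N,B_1,B_2\}$, nowhere vanishing curvatures $k_1(s),k_2(s),k_3(s)$, and $\varepsilon_1=\langle N,N\rangle\in\{+1,-1\}$. Put $\varphi(s)=\int_0^s k_1(t)\,dt$. Then $x$ is a spacelike $B_2$-slant helix if and only if there exist constants $C,D\in\mathbb{R}$ such that, for all $s\in I$, $$\frac{k_3(s)}{k_2(s)}=C\,\eta(\varphi(s))+D\,\mu(\varphi(s)),$$ where $\eta(\varphi)=\cosh(\varphi)$, $\mu(\varphi)=\sinh(\varphi)$ if $\varepsilon_1=-1$, and $\eta(\varphi)=\cos(\varphi)$, $\mu(\varphi)=\sin(\varphi)$ if $\varepsilon_1=+1$.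
   Context: Minkowski 4-space $E_1^4$ is $\mathbb{R}^4$ with the metric $\langle\,,\rangle=-dx_1^2+dx_2^2+dx_3^2+dx_4^2$. A vector $v$ is spacelike if $\langle v,v\rangle>0$ or $v=0$, timelike if $\langle v,v\rangle<0$, and lightlike if $\langle v,v\rangle=0$ and $v\ne 0$. A curve $x$ is unit speed spacelike if $\langle x'(s),x'(s)\rangle=1$ for all $s$. Curves and curvature functions are assumed sufficiently differentiable, with $I$ an interval. The Frenet frame $\{T,N,B_1,B_2\}$ along $x$ (tangent $T=x'$, principal normal, first binormal, second binormal) is a frame of mutually orthogonal vector fields with $\langle T,T\rangle=1$, $\langle N,N\rangle=\varepsilon_1$, $\langle B_2,B_2\rangle=\varepsilon_2$, $\langle B_1,B_1\rangle=-\varepsilon_1\varepsilon_2$, where $(\varepsilon_1,\varepsilon_2)\in\{(1,1),(1,-1),(-1,1)\}$, satisfying $$T'=k_1N,\quad N'=-\varepsilon_1k_1T+k_2B_1,\quad B_1'=\varepsilon_2k_2N+k_3B_2,\quad B_2'=\varepsilon_1k_3B_1 .$$ The functions $k_1,k_2,k_3$ are the first, second and third curvatures; it is assumed that $k_i(s)\neq0$ for all $s$ and $i=1,2,3$. The curve $x$ is called a spacelike $B_2$-slant helix if $B_2$ makes a constant angle with a fixed direction given by a "unit" vector $U$, that is, if there is a fixed (constant) vector $U$ with $\langle B_2(s),U\rangle$ constant along the curve. Here $U\neq 0$ may be spacelike, timelike or lightlike, with $\langle U,U\rangle=+1,-1$ or $0$ respectively. *)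

theory Defs
  imports "HOL-Analysis.Analysis"
begin

definition mink :: "real^4 \<Rightarrow> real^4 \<Rightarrow> real" where
  "mink v w = - (v$1 * w$1) + v$2 * w$2 + v$3 * w$3 + v$4 * w$4"

text \<open>The interval \<open>I\<close> may be open, closed or half-open, so derivatives are taken within \<open>I\<close>
  (one-sided at an endpoint belonging to \<open>I\<close>).\<close>

definition unit_speed_spacelike :: "real set \<Rightarrow> (real \<Rightarrow> real^4) \<Rightarrow> bool" where
  "unit_speed_spacelike I x \<longleftrightarrow>
     (\<forall>s\<in>I. x differentiable (at s within I) \<and>
       mink (vector_derivative x (at s within I)) (vector_derivative x (at s within I)) = 1)"

text \<open>The signs are \<open>e1 = \<langle>N, N\<rangle>\<close> and \<open>e2 = \<langle>B2, B2\<rangle>\<close>. Sufficient differentiability of the curve is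
  read as: the derivatives in the Frenet equations exist and the curvatures are continuous,
  which is what a curve of class \<open>C\<^sup>4\<close> provides.\<close>

definition frenet_frame ::
  "real set \<Rightarrow> (real \<Rightarrow> real^4) \<Rightarrow>
   (real \<Rightarrow> real^4) \<Rightarrow> (real \<Rightarrow> real^4) \<Rightarrow> (real \<Rightarrow> real^4) \<Rightarrow> (real \<Rightarrow> real^4) \<Rightarrow>
   (real \<Rightarrow> real) \<Rightarrow> (real \<Rightarrow> real) \<Rightarrow> (real \<Rightarrow> real) \<Rightarrow> real \<Rightarrow> real \<Rightarrow> bool" where
  "frenet_frame I x T N B1 B2 k1 k2 k3 e1 e2 \<longleftrightarrow>
     (e1, e2) \<in> {(1, 1), (1, -1), (-1, 1)} \<and>
     continuous_on I k1 \<and> continuous_on I k2 \<and> continuous_on I k3 \<and>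
     (\<forall>s\<in>I.
       mink (T s) (T s) = 1 \<and> mink (N s) (N s) = e1 \<and>
       mink (B1 s) (B1 s) = - e1 * e2 \<and> mink (B2 s) (B2 s) = e2 \<and>
       mink (T s) (N s) = 0 \<and> mink (T s) (B1 s) = 0 \<and> mink (T s) (B2 s) = 0 \<and>
       mink (N s) (B1 s) = 0 \<and> mink (N s) (B2 s) = 0 \<and> mink (B1 s) (B2 s) = 0 \<and>
       (x has_vector_derivative T s) (at s within I) \<and>
       (T has_vector_derivative k1 s *\<^sub>R N s) (at s within I) \<and>
       (N has_vector_derivative (- e1 * k1 s) *\<^sub>R T s + k2 s *\<^sub>R B1 s) (at s within I) \<and>
       (B1 has_vector_derivative (e2 * k2 s) *\<^sub>R N s + k3 s *\<^sub>R B2 s) (at s within I) \<and>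
       (B2 has_vector_derivative (e1 * k3 s) *\<^sub>R B1 s) (at s within I))"

text \<open>A ``unit'' vector is a nonzero spacelike or timelike vector normalised to \<open>1\<close> or \<open>-1\<close>, or
  any lightlike vector.\<close>

definition unit_direction :: "real^4 \<Rightarrow> bool" where
  "unit_direction U \<longleftrightarrow> U \<noteq> 0 \<and> mink U U \<in> {1, -1, 0}"

text \<open>The argument \<open>B2\<close> is the second binormal field of the curve.\<close>

definition B2_slant_helix :: "real set \<Rightarrow> (real \<Rightarrow> real^4) \<Rightarrow> bool" where
  "B2_slant_helix I B2 \<longleftrightarrow> (\<exists>U. unit_direction U \<and> (\<exists>c. \<forall>s\<in>I. mink (B2 s) U = c))"

definition eta :: "real \<Rightarrow> real \<Rightarrow> real" where
  "eta e1 p = (if e1 = -1 then cosh p else cos p)"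

definition mu :: "real \<Rightarrow> real \<Rightarrow> real" where
  "mu e1 p = (if e1 = -1 then sinh p else sin p)"

text \<open>The interval integral is oriented, as needed for \<open>s < 0\<close>.\<close>

definition total_curvature :: "(real \<Rightarrow> real) \<Rightarrow> real \<Rightarrow> real" where
  "total_curvature k1 s = (LBINT t=ereal 0..ereal s. k1 t)"

end

theory Submission
  imports Defs
begin

text \<open>
  Both directions rest on one computation. For a constant vector \<open>U\<close>, the Frenet equations turn
  into linear equations for the products of \<open>U\<close> with the frame: if \<open>\<langle>B2, U\<rangle>\<close> is a constant
  \<open>c\<close>, then \<open>\<langle>B1, U\<rangle> = 0\<close> because \<open>k3 \<noteq> 0\<close>, and differentiating once more gives
  \<open>e2 k2 \<langle>N, U\<rangle> + c k3 = 0\<close>. The two remaining products \<open>t = \<langle>T, U\<rangle>\<close> and \<open>n = \<langle>N, U\<rangle>\<close> satisfy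
  \<open>t' = k1 n\<close> and \<open>n' = - e1 k1 t\<close>. In the parameter \<open>\<phi> = \<integral> k1\<close> this is the
  equation of the circular (\<open>e1 = 1\<close>) or hyperbolic (\<open>e1 = -1\<close>) rotation, so \<open>n\<close> is a linear
  combination of \<open>eta\<close> and \<open>mu\<close> at \<open>\<phi>\<close> (\<open>rotation_system_solution\<close>), and so is
  \<open>k3 / k2 = - e2 n / c\<close>. The case \<open>c = 0\<close> cannot occur: it would force \<open>n = 0\<close>, then
  \<open>t = 0\<close> because \<open>k1 \<noteq> 0\<close>, so \<open>U\<close> would be orthogonal to the whole frame and vanish,
  since four orthogonal non-null vectors span the space (\<open>mink_orthogonal_frame_imp_zero\<close>).

  Conversely, if \<open>k3 / k2\<close> has the stated form, then reading the same equations backwards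
  prescribes the coefficients of a vector field \<open>U\<close> in the frame, normalised by \<open>\<langle>B2, U\<rangle> = 1\<close>.
  Its derivative vanishes, so it is a fixed nonzero direction, and rescaling makes it a unit
  one.
\<close>

section \<open>The Minkowski product\<close>

lemma mink_commute: "mink v w = mink w v"
  by (simp add: mink_def mult.commute)

lemma mink_simps [simp]:
  "mink (v + v') w = mink v w + mink v' w"
  "mink (- v) w = - mink v w"
  "mink (v - v') w = mink v w - mink v' w"
  "mink v (w + w') = mink v w + mink v w'"
  "mink (a *\<^sub>R v) w = a * mink v w"
  "mink v (a *\<^sub>R w) = a * mink v w"
  "mink 0 w = 0"
  "mink v 0 = 0"
  by (simp_all add: mink_def algebra_simps)

lemma has_real_derivative_mink_left:
  assumes "(f has_vector_derivative f') (at s within I)"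
  shows "((\<lambda>s. mink (f s) U) has_real_derivative mink f' U) (at s within I)"
proof -
  have "bounded_linear (\<lambda>v. mink v U)"
    by (intro linear_conv_bounded_linear[THEN iffD1] linearI) simp_all
  from bounded_linear.has_vector_derivative[OF this assms] show ?thesis
    by (simp add: has_real_derivative_iff_has_vector_derivative)
qed

lemma mink_nondegenerate:
  assumes "\<And>v. mink v U = 0"
  shows "U = 0"
proof -
  have "mink (axis i 1) U = 0" for i :: 4
    by (rule assms)
  from this[of 1] this[of 2] this[of 3] this[of 4] show ?thesis
    by (simp add: mink_def axis_def vec_eq_iff forall_4)
qed

lemma mink_zero_on_span:
  assumes "\<And>v. v \<in> S \<Longrightarrow> mink v w = 0" and "v \<in> span S"
  shows "mink v w = 0"
  using assms(2)
  by (rule span_induct) (auto intro!: subspaceI simp: assms(1))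

text \<open>The usual argument for orthogonal vectors, with positivity of the product replaced by the
  requirement that no vector of the family be lightlike.\<close>

lemma mink_orthogonal_independent:
  assumes "pairwise (\<lambda>v w. mink v w = 0) S" and "\<And>v. v \<in> S \<Longrightarrow> mink v v \<noteq> 0"
  shows "independent S"
  unfolding dependent_def
proof safe
  fix a assume a: "a \<in> S" "a \<in> span (S - {a})"
  have "mink a a = 0"
    by (rule mink_zero_on_span[OF _ a(2)]) (use assms(1) a(1) in \<open>auto simp: pairwise_def\<close>)
  with assms(2) a(1) show False by blast
qed

lemma mink_orthogonal_frame_imp_zero:
  assumes orth: "mink a b = 0" "mink a c = 0" "mink a d = 0"
      "mink b c = 0" "mink b d = 0" "mink c d = 0"
    and nonnull: "mink a a \<noteq> 0" "mink b b \<noteq> 0" "mink c c \<noteq> 0" "mink d d \<noteq> 0"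
    and U: "mink a U = 0" "mink b U = 0" "mink c U = 0" "mink d U = 0"
  shows "U = 0"
proof -
  let ?S = "{a, b, c, d}"
  have ne: "a \<noteq> b" "a \<noteq> c" "a \<noteq> d" "b \<noteq> c" "b \<noteq> d" "c \<noteq> d"
    using orth nonnull by auto
  have ind: "independent ?S"
    by (rule mink_orthogonal_independent)
      (use orth nonnull in \<open>auto simp: pairwise_def mink_commute\<close>)
  have "card ?S = 4" using ne by simp
  then have "UNIV \<subseteq> span ?S"
    by (intro card_ge_dim_independent[OF _ ind]) (simp_all add: dim_UNIV)
  then have "v \<in> span ?S" for v by blast
  then have "mink v U = 0" for v
    by (rule mink_zero_on_span[rotated]) (use U in auto)
  then show ?thesis by (rule mink_nondegenerate)
qed

section \<open>Rotation in the parameter \<open>\<phi>\<close>\<close>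

lemma eta_has_derivative:
  assumes "e = 1 \<or> e = -1"
  shows "(eta e has_real_derivative - e * mu e p) (at p)"
  using assms by (auto simp: eta_def[abs_def] mu_def[abs_def] intro!: derivative_eq_intros)

lemma mu_has_derivative:
  assumes "e = 1 \<or> e = -1"
  shows "(mu e has_real_derivative eta e p) (at p)"
  using assms by (auto simp: eta_def[abs_def] mu_def[abs_def] intro!: derivative_eq_intros)

lemma eta_mu_pythagoras:
  assumes "e = 1 \<or> e = -1"
  shows "(eta e p)\<^sup>2 + e * (mu e p)\<^sup>2 = 1"
  using assms by (auto simp: eta_def mu_def cosh_square_eq)

lemma eta_mu_comp_has_derivative:
  assumes e: "e = 1 \<or> e = -1" and "(\<phi> has_real_derivative k) (at s within I)"
  shows "((\<lambda>s. eta e (\<phi> s)) has_real_derivative - e * mu e (\<phi> s) * k) (at s within I)"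
    and "((\<lambda>s. mu e (\<phi> s)) has_real_derivative eta e (\<phi> s) * k) (at s within I)"
  by (rule DERIV_chain2[OF eta_has_derivative[OF e] assms(2)]
      DERIV_chain2[OF mu_has_derivative[OF e] assms(2)])+

text \<open>Rotating \<open>(n, t)\<close> back by the angle \<open>\<phi>\<close> gives a pair with zero derivative; its constant
  values are the coefficients.\<close>

lemma rotation_system_solution:
  fixes t n k \<phi> :: "real \<Rightarrow> real"
  assumes "convex I" and e: "e = 1 \<or> e = -1"
    and \<phi>: "\<And>s. s \<in> I \<Longrightarrow> (\<phi> has_real_derivative k s) (at s within I)"
    and t: "\<And>s. s \<in> I \<Longrightarrow> (t has_real_derivative k s * n s) (at s within I)"
    and n: "\<And>s. s \<in> I \<Longrightarrow> (n has_real_derivative - e * k s * t s) (at s within I)"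
  obtains A B where "\<And>s. s \<in> I \<Longrightarrow> n s = A * eta e (\<phi> s) + B * mu e (\<phi> s)"
proof -
  let ?h = "\<lambda>s. eta e (\<phi> s)" and ?m = "\<lambda>s. mu e (\<phi> s)"
  note dh = eta_mu_comp_has_derivative(1)[OF e \<phi>] and dm = eta_mu_comp_has_derivative(2)[OF e \<phi>]
  have "((\<lambda>s. n s * ?h s + e * (t s * ?m s)) has_real_derivative 0) (at s within I)"
    if "s \<in> I" for s
    by (rule DERIV_cong[OF DERIV_add[OF DERIV_mult[OF n dh] DERIV_cmult[OF DERIV_mult[OF t dm]]]])
      (use that in \<open>simp_all add: algebra_simps\<close>)
  from has_field_derivative_zero_constant[OF \<open>convex I\<close> this]
  obtain A where A: "\<And>s. s \<in> I \<Longrightarrow> n s * ?h s + e * (t s * ?m s) = A" by auto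
  have "((\<lambda>s. e * (n s * ?m s - t s * ?h s)) has_real_derivative 0) (at s within I)"
    if "s \<in> I" for s
    by (rule DERIV_cong[OF DERIV_cmult[OF DERIV_diff[OF DERIV_mult[OF n dm] DERIV_mult[OF t dh]]]])
      (use that in \<open>simp_all add: algebra_simps\<close>)
  from has_field_derivative_zero_constant[OF \<open>convex I\<close> this]
  obtain B where B: "\<And>s. s \<in> I \<Longrightarrow> e * (n s * ?m s - t s * ?h s) = B" by auto
  have "n s = A * ?h s + B * ?m s" if "s \<in> I" for s
  proof -
    have "A * ?h s + B * ?m s = n s * ((?h s)\<^sup>2 + e * (?m s)\<^sup>2)"
      unfolding A[OF that, symmetric] B[OF that, symmetric]
      by (simp add: algebra_simps power2_eq_square)
    then show ?thesis by (simp add: eta_mu_pythagoras[OF e])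
  qed
  then show thesis by (rule that)
qed

section \<open>Calculus on an interval\<close>

lemma at_within_interval_nontrivial:
  fixes I :: "real set"
  assumes "is_interval I" "0 \<in> I" "I \<noteq> {0}" "s \<in> I"
  shows "at s within I \<noteq> bot"
proof -
  have "s islimpt I"
    by (rule connected_imp_perfect) (use assms in \<open>auto simp: is_interval_connected\<close>)
  then show ?thesis by (simp add: trivial_limit_within)
qed

text \<open>This reduces to the fundamental theorem of calculus on a compact interval: near \<open>s\<close>, the
  interval \<open>I\<close> agrees with any compact subinterval containing \<open>0\<close> and \<open>s\<close> that reaches
  beyond \<open>s\<close> on each side on which \<open>I\<close> does.\<close>

lemma total_curvature_has_derivative:
  assumes I: "is_interval I" "0 \<in> I" and cont: "continuous_on I k" and s: "s \<in> I"
  shows "(total_curvature k has_real_derivative k s) (at s within I)"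
proof -
  obtain b where b: "b \<in> I" "s \<le> b" "0 \<le> b" "b = s \<Longrightarrow> \<forall>y\<in>I. y \<le> s"
  proof (cases "\<exists>p\<in>I. s < p")
    case True
    then obtain p where "p \<in> I" "s < p" by blast
    then show thesis using that[of "max p 0"] I by (cases "p \<le> 0") auto
  next
    case False
    then show thesis using that[of s] I s by force
  qed
  obtain a where a: "a \<in> I" "a \<le> s" "a \<le> 0" "a = s \<Longrightarrow> \<forall>y\<in>I. s \<le> y"
  proof (cases "\<exists>p\<in>I. p < s")
    case True
    then obtain p where "p \<in> I" "p < s" by blast
    then show thesis using that[of "min p 0"] I by (cases "p \<le> 0") auto
  next
    case False
    then show thesis using that[of s] I s by force
  qed
  have sub: "{a..b} \<subseteq> I"
    using mem_is_interval_1_I[OF I(1) a(1) b(1)] by auto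
  have "((\<lambda>u. LBINT y=ereal 0..ereal u. k y) has_vector_derivative k s) (at s within {a..b})"
    by (rule interval_integral_FTC2) (use a b continuous_on_subset[OF cont sub] in auto)
  then have "(total_curvature k has_real_derivative k s) (at s within {a..b})"
    by (simp add: total_curvature_def[abs_def] has_real_derivative_iff_has_vector_derivative)
  \<comment> \<open>If \<open>s\<close> is itself an endpoint, the neighbourhood \<open>{?l<..<?u}\<close> may extend past it, since
    then \<open>I\<close> has no points there either.\<close>
  moreover have "at s within {a..b} = at s within I"
  proof (rule at_within_nhd)
    let ?l = "if a = s then s - 1 else a" and ?u = "if b = s then s + 1 else b"
    show "s \<in> {?l<..<?u}" "open {?l<..<?u}" using a b by auto
    show "{a..b} \<inter> {?l<..<?u} - {s} = I \<inter> {?l<..<?u} - {s}"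
      using sub a(4) b(4) by (auto split: if_splits intro: antisym)
  qed
  ultimately show ?thesis by simp
qed

section \<open>The two implications\<close>

text \<open>A vector with \<open>\<langle>U, U\<rangle> \<noteq> 0\<close> can be normalised, and a lightlike one need not be.\<close>

lemma B2_slant_helixI:
  assumes "U \<noteq> 0" and "\<And>s. s \<in> I \<Longrightarrow> mink (B2 s) U = c"
  shows "B2_slant_helix I B2"
proof -
  let ?q = "mink U U"
  define r where "r = (if ?q = 0 then 1 else 1 / sqrt \<bar>?q\<bar>)"
  have "r \<noteq> 0" by (simp add: r_def)
  have "r\<^sup>2 * ?q \<in> {1, -1, 0}"
    by (auto simp: r_def power_divide abs_if)
  then have "unit_direction (r *\<^sub>R U)"
    using assms(1) \<open>r \<noteq> 0\<close> by (auto simp: unit_direction_def power2_eq_square mult.assoc)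
  moreover have "\<forall>s\<in>I. mink (B2 s) (r *\<^sub>R U) = r * c"
    using assms(2) by simp
  ultimately show ?thesis unfolding B2_slant_helix_def by blast
qed

lemma slant_helix_imp_curvature_ratio:
  assumes I: "is_interval I" "0 \<in> I" "I \<noteq> {0}"
    and F: "frenet_frame I x T N B1 B2 k1 k2 k3 e1 e2"
    and nz: "\<forall>s\<in>I. k1 s \<noteq> 0 \<and> k2 s \<noteq> 0 \<and> k3 s \<noteq> 0"
    and helix: "B2_slant_helix I B2"
  shows "\<exists>C D. \<forall>s\<in>I. k3 s / k2 s =
      C * eta e1 (total_curvature k1 s) + D * mu e1 (total_curvature k1 s)"
proof -
  obtain U c where "U \<noteq> 0" and c: "\<And>s. s \<in> I \<Longrightarrow> mink (B2 s) U = c"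
    using helix by (auto simp: B2_slant_helix_def unit_direction_def)
  have e: "e1 = 1 \<or> e1 = -1" "e2 = 1 \<or> e2 = -1"
    using F by (auto simp: frenet_frame_def)
  \<comment> \<open>the form in which constancy of a product with \<open>U\<close> yields the next equation\<close>
  have const: "a = 0"
    if "(f has_real_derivative a) (at s within I)" "s \<in> I" "\<And>s. s \<in> I \<Longrightarrow> f s = d"
    for f a s d
  proof -
    have "((\<lambda>_. d) has_real_derivative a) (at s within I)"
      by (rule has_field_derivative_transform_within[OF that(1) zero_less_one that(2)])
        (use that(3) in auto)
    then show ?thesis
      using vector_derivative_unique_within[OF at_within_interval_nontrivial[OF I that(2)]]
        has_vector_derivative_const
      by (metis has_real_derivative_iff_has_vector_derivative)
  qed
  have dT: "((\<lambda>s. mink (T s) U) has_real_derivative k1 s * mink (N s) U) (at s within I)"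
    and dN: "((\<lambda>s. mink (N s) U) has_real_derivative
      - e1 * k1 s * mink (T s) U + k2 s * mink (B1 s) U) (at s within I)"
    and dB1: "((\<lambda>s. mink (B1 s) U) has_real_derivative
      e2 * k2 s * mink (N s) U + k3 s * mink (B2 s) U) (at s within I)"
    and dB2: "((\<lambda>s. mink (B2 s) U) has_real_derivative e1 * k3 s * mink (B1 s) U) (at s within I)"
    if "s \<in> I" for s
    using F that by (auto simp: frenet_frame_def dest!: bspec has_real_derivative_mink_left[where U=U])
  have b1: "mink (B1 s) U = 0" if "s \<in> I" for s
    using const[OF dB2 that c, OF that] nz e that by auto
  have n: "e2 * k2 s * mink (N s) U + k3 s * c = 0" if "s \<in> I" for s
    using const[OF dB1 that b1, OF that] c[OF that] by simp
  obtain A B where AB: "\<And>s. s \<in> I \<Longrightarrow>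
      mink (N s) U = A * eta e1 (total_curvature k1 s) + B * mu e1 (total_curvature k1 s)"
  proof (rule rotation_system_solution[of I e1 "total_curvature k1" k1
        "\<lambda>s. mink (T s) U" "\<lambda>s. mink (N s) U"])
    show "convex I" using I(1) by (rule is_interval_convex)
    show "(total_curvature k1 has_real_derivative k1 s) (at s within I)" if "s \<in> I" for s
      using total_curvature_has_derivative[OF I(1,2) _ that] F by (simp add: frenet_frame_def)
    show "((\<lambda>s. mink (N s) U) has_real_derivative - e1 * k1 s * mink (T s) U) (at s within I)"
      if "s \<in> I" for s
      using dN[OF that] b1[OF that] by simp
  qed (use e dT in auto)
  have "c \<noteq> 0"
  proof
    assume "c = 0"
    have n0: "mink (N s) U = 0" if "s \<in> I" for s
      using n[OF that] \<open>c = 0\<close> nz e that by auto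
    have "mink (T 0) U = 0"
      using const[OF dN _ n0, of 0] b1 nz e I(2) by auto
    moreover have "mink (N 0) U = 0" "mink (B1 0) U = 0" "mink (B2 0) U = 0"
      using n0 b1 c \<open>c = 0\<close> I(2) by auto
    ultimately have "U = 0"
      using F I(2) e
      by (intro mink_orthogonal_frame_imp_zero[of "T 0" "N 0" "B1 0" "B2 0"])
        (auto simp: frenet_frame_def)
    with \<open>U \<noteq> 0\<close> show False ..
  qed
  have "k3 s / k2 s = (- e2 * A / c) * eta e1 (total_curvature k1 s)
      + (- e2 * B / c) * mu e1 (total_curvature k1 s)" if "s \<in> I" for s
  proof -
    have "k3 s / k2 s = - e2 / c * mink (N s) U"
      using n[OF that] \<open>c \<noteq> 0\<close> nz that by (auto simp: field_simps)
    then show ?thesis using AB[OF that] by (simp add: algebra_simps)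
  qed
  then show ?thesis by blast
qed

lemma curvature_ratio_imp_slant_helix:
  assumes I: "is_interval I" "0 \<in> I"
    and F: "frenet_frame I x T N B1 B2 k1 k2 k3 e1 e2"
    and nz: "\<forall>s\<in>I. k2 s \<noteq> 0"
    and ratio: "\<forall>s\<in>I. k3 s / k2 s =
      C * eta e1 (total_curvature k1 s) + D * mu e1 (total_curvature k1 s)"
  shows "B2_slant_helix I B2"
proof -
  have e: "e1 = 1 \<or> e1 = -1" "e2 = 1 \<or> e2 = -1"
    using F by (auto simp: frenet_frame_def)
  let ?h = "\<lambda>s. eta e1 (total_curvature k1 s)" and ?m = "\<lambda>s. mu e1 (total_curvature k1 s)"
  \<comment> \<open>The values of \<open>\<langle>N, U\<rangle>\<close> and \<open>\<langle>T, U\<rangle>\<close> that solve the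
    equations for \<open>\<langle>B2, U\<rangle> = 1\<close>. In the expansion of \<open>U\<close> each product
    is multiplied by the sign of the frame vector.\<close>
  define n where "n s = - e2 * (C * ?h s + D * ?m s)" for s
  define t where "t s = e2 * (e1 * D * ?h s - C * ?m s)" for s
  define U where "U s = t s *\<^sub>R T s + (e1 * n s) *\<^sub>R N s + e2 *\<^sub>R B2 s" for s
  have n_eq: "n s * k2 s = - e2 * k3 s" if "s \<in> I" for s
    using ratio nz that by (auto simp: n_def field_simps)
  have dU: "(U has_vector_derivative 0) (at s within I)" if "s \<in> I" for s
  proof -
    have "(total_curvature k1 has_real_derivative k1 s) (at s within I)"
      using total_curvature_has_derivative[OF I _ that] F by (simp add: frenet_frame_def)
    note deriv = eta_mu_comp_has_derivative[OF e(1) this]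
    have dt: "(t has_real_derivative k1 s * n s) (at s within I)"
      unfolding t_def n_def
      by (rule derivative_eq_intros deriv refl)+ (use e in \<open>auto simp: algebra_simps\<close>)
    have dn: "(n has_real_derivative - e1 * k1 s * t s) (at s within I)"
      unfolding t_def n_def
      by (rule derivative_eq_intros deriv refl)+ (use e in \<open>auto simp: algebra_simps\<close>)
    have dT: "(T has_vector_derivative k1 s *\<^sub>R N s) (at s within I)"
      and dN: "(N has_vector_derivative (- e1 * k1 s) *\<^sub>R T s + k2 s *\<^sub>R B1 s) (at s within I)"
      and dB2: "(B2 has_vector_derivative (e1 * k3 s) *\<^sub>R B1 s) (at s within I)"
      using F that by (auto simp: frenet_frame_def)
    have "(U has_vector_derivative
        (t s *\<^sub>R (k1 s *\<^sub>R N s) + (k1 s * n s) *\<^sub>R T s)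
        + ((e1 * n s) *\<^sub>R ((- e1 * k1 s) *\<^sub>R T s + k2 s *\<^sub>R B1 s) + (e1 * (- e1 * k1 s * t s)) *\<^sub>R N s)
        + e2 *\<^sub>R ((e1 * k3 s) *\<^sub>R B1 s)) (at s within I)"
      unfolding U_def
      by (intro has_vector_derivative_add has_vector_derivative_scaleR DERIV_cmult dt dn dT dN dB2
          bounded_linear.has_vector_derivative[OF bounded_linear_scaleR_right])
    moreover have "(t s *\<^sub>R (k1 s *\<^sub>R N s) + (k1 s * n s) *\<^sub>R T s)
        + ((e1 * n s) *\<^sub>R ((- e1 * k1 s) *\<^sub>R T s + k2 s *\<^sub>R B1 s) + (e1 * (- e1 * k1 s * t s)) *\<^sub>R N s)
        + e2 *\<^sub>R ((e1 * k3 s) *\<^sub>R B1 s)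
        = (t s * k1 s * (1 - e1 * e1)) *\<^sub>R N s + (k1 s * n s * (1 - e1 * e1)) *\<^sub>R T s
          + (e1 * (n s * k2 s + e2 * k3 s)) *\<^sub>R B1 s"
      by (simp add: algebra_simps)
    ultimately show ?thesis
      using e n_eq[OF that] by auto
  qed
  obtain V where V: "\<And>s. s \<in> I \<Longrightarrow> U s = V"
    using has_vector_derivative_zero_constant[OF is_interval_convex[OF I(1)] dU] by blast
  have b2: "mink (B2 s) V = 1" if "s \<in> I" for s
  proof -
    have "mink (B2 s) (T s) = 0" "mink (B2 s) (N s) = 0" "mink (B2 s) (B2 s) = e2"
      using F that by (auto simp: frenet_frame_def mink_commute)
    then have "mink (B2 s) (U s) = e2 * e2" by (simp add: U_def)
    then show ?thesis using V[OF that] e(2) by auto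
  qed
  show ?thesis
  proof (rule B2_slant_helixI)
    show "V \<noteq> 0" using b2[OF I(2)] by auto
  qed (rule b2)
qed

theorem theorem3p3:
  fixes I :: "real set" and x T N B1 B2 :: "real \<Rightarrow> real^4"
    and k1 k2 k3 :: "real \<Rightarrow> real" and e1 e2 :: real
  assumes "is_interval I" and "0 \<in> I" and "I \<noteq> {0}"
    and "unit_speed_spacelike I x"
    and "frenet_frame I x T N B1 B2 k1 k2 k3 e1 e2"
    and "\<forall>s\<in>I. k1 s \<noteq> 0 \<and> k2 s \<noteq> 0 \<and> k3 s \<noteq> 0"
  shows "B2_slant_helix I B2 \<longleftrightarrow>
    (\<exists>C D. \<forall>s\<in>I. k3 s / k2 s =
       C * eta e1 (total_curvature k1 s) + D * mu e1 (total_curvature k1 s))"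
  using slant_helix_imp_curvature_ratio[OF assms(1-3,5,6)]
    curvature_ratio_imp_slant_helix[OF assms(1,2,5)] assms(6)
  by blast

end
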